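(* Let $\mathfrak{h}$ be a 6-dimensional real Lie algebra with basis $\{e_1,\dots,e_6\}$, let $D$ be a derivation of $\mathfrak{h}$ with $D\in\mathfrak{sp}(6,\mathbb{R})$ with respect to the basis $\{e_1,\dots,e_6\}$, and let $\mathfrak{g}=\mathfrak{h}\oplus_D\mathbb{R}e_7$. Suppose that the $\mathrm{G}_2$ form $$\varphi=e^{127}+e^{347}+e^{567}-e^{136}-e^{145}-e^{235}+e^{246}$$ on $\mathfrak{g}$ (written in the basis $\{e^1,\dots,e^7\}$ dual to $\{e_1,\dots,e_7\}$) is coclosed. Then $\mathfrak{h}$ has a half-flat $\mathrm{SU}(3)$-structure.
   Context: Notation: for a basis $\{e_i\}$ of a Lie algebra with dual basis $\{e^i\}$, $e^{ij}=e^i\wedge e^j$, $e^{ijk}=e^i\wedge e^j\wedge e^k$, etc. $d$ is the Chevalley–Eilenberg differential, with $d\alpha(X,Y)=-\alpha([X,Y])$ on 1-forms. $D\in\mathfrak{sp}(6,\mathbb{R})$ with respect to $\{e_1,\dots,e_6\}$ means that $\omega_0(DX,Y)+\omega_0(X,DY)=0$ for all $X,Y\in\mathfrak{h}$, where $\omega_0=e^{12}+e^{34}+e^{56}$; equivalently the matrix of $D$ is of the form $$\begin{pmatrix} a_{11} & a_{12} & a_{13} & a_{14} & a_{15} & a_{16} \\ a_{21} & -a_{11} & a_{23} & a_{24} & a_{25} & a_{26} \\ -a_{24} & a_{14} & a_{33} & a_{34} & a_{35} & a_{36} \\ a_{23} & -a_{13} & a_{43} & -a_{33} & a_{45} & a_{46}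 \\ -a_{26} & a_{16} & -a_{46} & a_{36} & a_{55} & a_{56} \\ a_{25} & -a_{15} & a_{45} & -a_{35} & a_{65} & -a_{55} \end{pmatrix},\quad a_{ij}\in\mathbb{R}.$$ For a derivation $D$ of $\mathfrak{h}$, $\mathfrak{h}\oplus_D\mathbb{R}e_7$ is the vector space $\mathfrak{h}\oplus\mathbb{R}e_7$ with bracket extending that of $\mathfrak{h}$ and $[e_7,U]=D(U)$ for $U\in\mathfrak{h}$. The $\mathrm{G}_2$ form $\varphi$ induces on $\mathfrak{g}$ the metric and orientation for which $\{e^1,\dots,e^7\}$ is an oriented orthonormal basis; $\ast$ is the corresponding Hodge star, and $\varphi$ is coclosed if $d\ast\varphi=0$. An $\mathrm{SU}(3)$-structure on a 6-dimensional real Lie algebra $\mathfrak{h}$ is given by a pair $(\omega,\psi_+)\in\Lambda^2\mathfrak{h}^*\times\Lambda^3\mathfrak{h}^*$ for which there is a basis $\{f^1,\dots,f^6\}$ of $\mathfrak{h}^*$ with $\omega=f^{12}+f^{34}+f^{56}$ and $\psi_+=f^{135}-f^{146}-f^{236}-f^{245}$. It is half-flat if $d(\omega\wedge\omega)=0$ and $d\psi_+=0$. *)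

theory Defs
  imports "HOL-Analysis.Analysis" "HOL-Library.Function_Algebras"
begin

section \<open>Lie algebras and semidirect extensions\<close>

definition lie_algebra :: "('a::real_vector \<Rightarrow> 'a \<Rightarrow> 'a) \<Rightarrow> bool" where
  "lie_algebra br \<longleftrightarrow> bilinear br \<and> (\<forall>x. br x x = 0) \<and>
     (\<forall>x y z. br x (br y z) + br y (br z x) + br z (br x y) = 0)"

definition derivation :: "('a::real_vector \<Rightarrow> 'a \<Rightarrow> 'a) \<Rightarrow> ('a \<Rightarrow> 'a) \<Rightarrow> bool" where
  "derivation br D \<longleftrightarrow> linear D \<and> (\<forall>x y. D (br x y) = br (D x) y + br x (D y))"

text \<open>The vector space \<open>h \<oplus> \<real>e\<close> is the product type; the added generator \<open>e\<close> is \<open>(0, 1)\<close>.\<close>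

definition semidirect_bracket ::
    "('a::real_vector \<Rightarrow> 'a \<Rightarrow> 'a) \<Rightarrow> ('a \<Rightarrow> 'a) \<Rightarrow> 'a \<times> real \<Rightarrow> 'a \<times> real \<Rightarrow> 'a \<times> real" where
  "semidirect_bracket br D = (\<lambda>(x, s) (y, t). (br x y + s *\<^sub>R D y - t *\<^sub>R D x, 0))"

lemma semidirect_bracket_extends:
  "semidirect_bracket br D (x, 0) (y, 0) = (br x y, 0)"
  by (simp add: semidirect_bracket_def)

lemma semidirect_bracket_generator:
  assumes "lie_algebra br" "derivation br D"
  shows "semidirect_bracket br D (0, 1) (y, 0) = (D y, 0)"
proof -
  have "br 0 y = 0" "D 0 = 0"
    using assms by (auto simp: lie_algebra_def derivation_def intro: bilinear_lzero linear_0)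
  then show ?thesis
    by (simp add: semidirect_bracket_def)
qed

lemma lie_algebra_semidirect:
  assumes L: "lie_algebra br" and D: "derivation br D"
  shows "lie_algebra (semidirect_bracket br D)"
proof -
  have bl: "bilinear br" and alt: "\<And>x. br x x = 0"
    and jac: "\<And>x y z. br x (br y z) + br y (br z x) + br z (br x y) = 0"
    using L by (auto simp: lie_algebra_def)
  have lin: "linear D" and der: "\<And>x y. D (br x y) = br (D x) y + br x (D y)"
    using D by (auto simp: derivation_def)
  note bs = bilinear_ladd[OF bl] bilinear_radd[OF bl] bilinear_lmul[OF bl] bilinear_rmul[OF bl]
    bilinear_lsub[OF bl] bilinear_rsub[OF bl] bilinear_lzero[OF bl] bilinear_rzero[OF bl]
    linear_add[OF lin] linear_diff[OF lin] linear_scale[OF lin] linear_0[OF lin]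
  have skew: "br x y = - br y x" for x y
  proof -
    have "br x y + br y x = 0"
      using alt[of "x + y"] alt[of x] alt[of y] by (simp add: bs add.commute)
    then show ?thesis
      by (simp add: eq_neg_iff_add_eq_0)
  qed
  have "bilinear (semidirect_bracket br D)"
    unfolding bilinear_def semidirect_bracket_def
    by (auto intro!: linearI simp: bs algebra_simps)
  moreover have "semidirect_bracket br D x x = 0" for x
    by (cases x) (simp add: semidirect_bracket_def alt zero_prod_def)
  moreover have "semidirect_bracket br D x (semidirect_bracket br D y z) +
      semidirect_bracket br D y (semidirect_bracket br D z x) +
      semidirect_bracket br D z (semidirect_bracket br D x y) = 0" for x y z
  proof -
    obtain a r b s c t where xyz: "x = (a, r)" "y = (b, s)" "z = (c, t)"
      by (metis surj_pair)
    have "br a (br b c + s *\<^sub>R D c - t *\<^sub>R D b) + r *\<^sub>R D (br b c + s *\<^sub>R D c - t *\<^sub>R D b)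
      + (br b (br c a + t *\<^sub>R D a - r *\<^sub>R D c) + s *\<^sub>R D (br c a + t *\<^sub>R D a - r *\<^sub>R D c))
      + (br c (br a b + r *\<^sub>R D b - s *\<^sub>R D a) + t *\<^sub>R D (br a b + r *\<^sub>R D b - s *\<^sub>R D a))
      = br a (br b c) + br b (br c a) + br c (br a b)
      + r *\<^sub>R (br (D b) c + br c (D b)) + s *\<^sub>R (br (D c) a + br a (D c))
      + t *\<^sub>R (br (D a) b + br b (D a))"
      by (simp add: bs der algebra_simps)
    also have "\<dots> = 0"
      using jac[of a b c] skew[of "D b" c] skew[of "D c" a] skew[of "D a" b] by simp
    finally show ?thesis
      unfolding xyz semidirect_bracket_def by (simp add: zero_prod_def)
  qed
  ultimately show ?thesis
    by (simp add: lie_algebra_def)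
qed

section \<open>Bases\<close>

text \<open>Bases are indexed by \<open>{1..n}\<close>; values outside this range are irrelevant.\<close>

definition is_basis :: "nat \<Rightarrow> (nat \<Rightarrow> 'a::real_vector) \<Rightarrow> bool" where
  "is_basis n e \<longleftrightarrow> inj_on e {1..n} \<and> independent (e ` {1..n}) \<and> span (e ` {1..n}) = UNIV"

definition dual_basis :: "nat \<Rightarrow> (nat \<Rightarrow> 'a::real_vector) \<Rightarrow> nat \<Rightarrow> 'a \<Rightarrow> real" where
  "dual_basis n e i = (\<lambda>v. representation (e ` {1..n}) v (e i))"

lemma dual_basis_basis:
  assumes "is_basis n e" "i \<in> {1..n}" "j \<in> {1..n}"
  shows "dual_basis n e i (e j) = (if i = j then 1 else 0)"
proof -
  have "representation (e ` {1..n}) (e j) = (\<lambda>b. if b = e j then 1 else 0)"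
    using assms by (intro representation_basis) (auto simp: is_basis_def)
  moreover have "e i = e j \<longleftrightarrow> i = j"
    using assms unfolding is_basis_def by (metis inj_on_eq_iff)
  ultimately show ?thesis
    by (simp add: dual_basis_def)
qed

text \<open>The dual space is the set of linear maps into \<open>\<real>\<close>, so a basis of it is a finite family of
  linear maps which is linearly independent and spans all of them.\<close>

definition is_dual_space_basis :: "nat \<Rightarrow> (nat \<Rightarrow> 'a::real_vector \<Rightarrow> real) \<Rightarrow> bool" where
  "is_dual_space_basis n f \<longleftrightarrow>
     (\<forall>i\<in>{1..n}. linear (f i)) \<and>
     (\<forall>c. (\<forall>v. (\<Sum>i=1..n. c i * f i v) = 0) \<longrightarrow> (\<forall>i\<in>{1..n}. c i = 0)) \<and>
     (\<forall>g. linear g \<longrightarrow> (\<exists>c. \<forall>v. g v = (\<Sum>i=1..n. c i * f i v)))"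

definition semidirect_basis :: "nat \<Rightarrow> (nat \<Rightarrow> 'a::real_vector) \<Rightarrow> nat \<Rightarrow> 'a \<times> real" where
  "semidirect_basis n e i = (if i = Suc n then (0, 1) else (e i, 0))"

section \<open>Exterior forms\<close>

text \<open>A \<open>k\<close>-form is encoded as a function on lists of vectors which is alternating multilinear on
  lists of length \<open>k\<close> and vanishes on lists of any other length.\<close>

type_synonym 'a form = "'a list \<Rightarrow> real"

definition forms :: "nat \<Rightarrow> 'a::real_vector form set" where
  "forms k = {\<alpha>. (\<forall>vs. length vs \<noteq> k \<longrightarrow> \<alpha> vs = 0) \<and>
     (\<forall>vs i. length vs = k \<and> i < k \<longrightarrow> linear (\<lambda>x. \<alpha> (vs[i := x]))) \<and>
     (\<forall>vs i j. length vs = k \<and> i < j \<and> j < k \<and> vs ! i = vs ! j \<longrightarrow> \<alpha> vs = 0)}"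

definition unit_form :: "'a form" where
  "unit_form vs = (if vs = [] then 1 else 0)"

definition covector :: "('a \<Rightarrow> real) \<Rightarrow> 'a form" where
  "covector f vs = (if length vs = 1 then f (vs ! 0) else 0)"

text \<open>The sign of the shuffle listing first the positions in \<open>I\<close> and then the others.\<close>

definition shuffle_sign :: "nat set \<Rightarrow> real" where
  "shuffle_sign I = (-1) ^ card {(i, j). i \<in> I \<and> j \<notin> I \<and> j < i}"

text \<open>For a \<open>p\<close>-form and a \<open>q\<close>-form only the sets \<open>I\<close> of size \<open>p\<close> contribute, so this is
  the usual sum over \<open>(p,q)\<close>-shuffles, normalised by \<open>(f \<and> g)(X, Y) = f X g Y - f Y g X\<close>.\<close>

definition wedge :: "'a form \<Rightarrow> 'a form \<Rightarrow> 'a form" where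
  "wedge \<alpha> \<beta> vs =
     (\<Sum>I\<in>Pow {..<length vs}. shuffle_sign I * \<alpha> (nths vs I) * \<beta> (nths vs (- I)))"

lemma wedge_covector:
  "wedge (covector f) (covector g) [x, y] = f x * g y - f y * g x"
proof -
  have P: "Pow {..<length [x, y]} = {{}, {0}, {1}, {0, 1}}"
    by (simp add: numeral_2_eq_2 lessThan_Suc Pow_insert) blast
  have "{(i, j). i \<in> {} \<and> j \<notin> {} \<and> j < (i::nat)} = {}"
    "{(i, j). i \<in> {0::nat} \<and> j \<notin> {0} \<and> j < i} = {}"
    "{(i, j). i \<in> {1::nat} \<and> j \<notin> {1} \<and> j < i} = {(1, 0)}"
    by auto
  then have "shuffle_sign {} = 1" "shuffle_sign {0} = 1" "shuffle_sign {1} = -1"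
    unfolding shuffle_sign_def by (simp_all only: card.empty card_insert_disjoint) simp_all
  then show ?thesis
    unfolding wedge_def P by (simp add: covector_def nths_Cons)
qed

text \<open>\<open>mono_form f [i, j, k]\<close> is \<open>f\<^sup>i\<^sup>j\<^sup>k = f\<^sup>i \<and> f\<^sup>j \<and> f\<^sup>k\<close>.\<close>

definition mono_form :: "(nat \<Rightarrow> 'a \<Rightarrow> real) \<Rightarrow> nat list \<Rightarrow> 'a form" where
  "mono_form f is = foldr (\<lambda>i. wedge (covector (f i))) is unit_form"

text \<open>Chevalley--Eilenberg differential: \<open>(d\<alpha>)(X\<^sub>0, \<dots>, X\<^sub>k)\<close> is the sum over \<open>i < j\<close> of
  \<open>(-1)\<^sup>i\<^sup>+\<^sup>j \<alpha>([X\<^sub>i, X\<^sub>j], X\<^sub>0, \<dots>)\<close> with \<open>X\<^sub>i\<close> and \<open>X\<^sub>j\<close> omitted from the dots.\<close>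

definition ce_d :: "('a \<Rightarrow> 'a \<Rightarrow> 'a) \<Rightarrow> 'a form \<Rightarrow> 'a form" where
  "ce_d br \<alpha> vs =
     (\<Sum>(i, j)\<in>{(i, j). i < j \<and> j < length vs}.
        (-1) ^ (i + j) * \<alpha> (br (vs ! i) (vs ! j) # nths vs (- {i, j})))"

lemma ce_d_covector: "ce_d br (covector f) [x, y] = - f (br x y)"
proof -
  have "{(i, j). i < j \<and> j < length [x, y]} = {(0, 1)}"
    by auto
  then show ?thesis
    by (simp add: ce_d_def covector_def nths_Cons)
qed

text \<open>The Hodge star of the metric and orientation for which \<open>e\<^sub>1, \<dots>, e\<^sub>n\<close> is an oriented
  orthonormal basis: \<open>\<star>\<alpha>\<close> is the sum over \<open>i\<^sub>1 < \<dots> < i\<^sub>k\<close> of \<open>\<alpha>(e\<^sub>i\<^sub>1, \<dots>, e\<^sub>i\<^sub>k)\<close> times the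
  contraction \<open>vol(e\<^sub>i\<^sub>1, \<dots>, e\<^sub>i\<^sub>k, \<dots>)\<close>. Thus \<open>\<star>e\<^sup>I = \<plusminus>e\<^sup>J\<close> with \<open>J\<close> complementary to \<open>I\<close> and
  the sign for which \<open>e\<^sup>I \<and> \<star>e\<^sup>I = vol\<close>.\<close>

definition volume_form :: "nat \<Rightarrow> (nat \<Rightarrow> 'a::real_vector) \<Rightarrow> 'a form" where
  "volume_form n e = mono_form (dual_basis n e) [1..<Suc n]"

definition hodge_star :: "nat \<Rightarrow> (nat \<Rightarrow> 'a::real_vector) \<Rightarrow> 'a form \<Rightarrow> 'a form" where
  "hodge_star n e \<alpha> vs =
     (\<Sum>I\<in>Pow {1..n}. \<alpha> (map e (sorted_list_of_set I)) *
        volume_form n e (map e (sorted_list_of_set I) @ vs))"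

section \<open>Symplectic endomorphisms, coclosed forms and SU(3)-structures\<close>

definition in_sp6 :: "(nat \<Rightarrow> 'a::real_vector) \<Rightarrow> ('a \<Rightarrow> 'a) \<Rightarrow> bool" where
  "in_sp6 e D \<longleftrightarrow>
     (let \<epsilon> = dual_basis 6 e;
          \<omega>\<^sub>0 = mono_form \<epsilon> [1,2] + mono_form \<epsilon> [3,4] + mono_form \<epsilon> [5,6]
      in \<forall>x y. \<omega>\<^sub>0 [D x, y] + \<omega>\<^sub>0 [x, D y] = 0)"

text \<open>The standard \<open>G\<^sub>2\<close> form in the coframe \<open>\<epsilon>\<close>. If \<open>\<epsilon>\<close> is the dual basis of \<open>e\<close>, its induced
  metric and orientation are those for which \<open>e\<close> is an oriented orthonormal basis.\<close>

definition g2_form :: "(nat \<Rightarrow> 'a \<Rightarrow> real) \<Rightarrow> 'a form" where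
  "g2_form \<epsilon> =
     mono_form \<epsilon> [1,2,7] + mono_form \<epsilon> [3,4,7] + mono_form \<epsilon> [5,6,7]
     - mono_form \<epsilon> [1,3,6] - mono_form \<epsilon> [1,4,5] - mono_form \<epsilon> [2,3,5] + mono_form \<epsilon> [2,4,6]"

definition coclosed ::
    "('a::real_vector \<Rightarrow> 'a \<Rightarrow> 'a) \<Rightarrow> nat \<Rightarrow> (nat \<Rightarrow> 'a) \<Rightarrow> 'a form \<Rightarrow> bool" where
  "coclosed br n e \<phi> \<longleftrightarrow> ce_d br (hodge_star n e \<phi>) = 0"

definition su3_structure :: "'a::real_vector form \<Rightarrow> 'a form \<Rightarrow> bool" where
  "su3_structure \<omega> \<psi> \<longleftrightarrow> \<omega> \<in> forms 2 \<and> \<psi> \<in> forms 3 \<and>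
     (\<exists>f. is_dual_space_basis 6 f \<and>
        \<omega> = mono_form f [1,2] + mono_form f [3,4] + mono_form f [5,6] \<and>
        \<psi> = mono_form f [1,3,5] - mono_form f [1,4,6] - mono_form f [2,3,6] - mono_form f [2,4,5])"

definition half_flat :: "('a \<Rightarrow> 'a \<Rightarrow> 'a) \<Rightarrow> 'a form \<Rightarrow> 'a form \<Rightarrow> bool" where
  "half_flat br \<omega> \<psi> \<longleftrightarrow> ce_d br (wedge \<omega> \<omega>) = 0 \<and> ce_d br \<psi> = 0"

end

theory Submission
  imports Defs
begin

text \<open>With \<open>\<omega>\<^sub>0 = e\<^sup>1\<^sup>2 + e\<^sup>3\<^sup>4 + e\<^sup>5\<^sup>6\<close> and
  \<open>\<psi>\<^sub>+ = e\<^sup>1\<^sup>3\<^sup>5 - e\<^sup>1\<^sup>4\<^sup>6 - e\<^sup>2\<^sup>3\<^sup>6 - e\<^sup>2\<^sup>4\<^sup>5\<close> one has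
  \<open>\<star>\<phi> = \<omega>\<^sub>0\<^sup>2/2 + \<psi>\<^sub>+ \<and> e\<^sup>7\<close>. Restricting \<open>d \<star>\<phi> = 0\<close> to the ideal \<open>h\<close> gives
  \<open>d(\<omega>\<^sub>0\<^sup>2) = 0\<close>. Contracting it with \<open>e\<^sub>7\<close> gives \<open>d\<psi>\<^sub>+\<close> up to sign, plus the derivative of
  \<open>\<omega>\<^sub>0\<^sup>2/2\<close> along \<open>D\<close>, which vanishes because \<open>D\<close> is symplectic. Hence
  \<open>(\<omega>\<^sub>0, \<psi>\<^sub>+)\<close> itself is half-flat on \<open>h\<close>.\<close>

subsection \<open>Monomial forms\<close>

lemma nths_Cons_Compl_0 [simp]: "nths (v # vs) (- {0}) = vs"
proof -
  have "{j. Suc j \<in> - {0}} = UNIV" by auto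
  then show ?thesis by (simp add: nths_Cons nths_all)
qed

lemma nths_Cons_Compl_Suc [simp]: "nths (v # vs) (- {Suc m}) = v # nths vs (- {m})"
proof -
  have "{j. Suc j \<in> - {Suc m}} = - {m}" by auto
  then show ?thesis by (simp add: nths_Cons)
qed

lemma nths_singleton_nth: "m < length vs \<Longrightarrow> nths vs {m} = [vs ! m]"
proof (induction vs arbitrary: m)
  case (Cons v vs)
  have "{j. Suc j \<in> {0}} = {}" "{j. Suc j \<in> {Suc k}} = {k}" for k by auto
  with Cons show ?case by (cases m) (auto simp: nths_Cons)
qed simp

lemma length_nths_Pow: "I \<in> Pow {..<length vs} \<Longrightarrow> length (nths vs I) = card I"
  by (auto simp: length_nths intro!: arg_cong[where f = card])

lemma length_nths_Compl: "length (nths vs (- I)) + length (nths vs I) = length vs"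
proof -
  have "card {i. i < length vs \<and> i \<in> - I} + card {i. i < length vs \<and> i \<in> I}
      = card ({i. i < length vs \<and> i \<in> - I} \<union> {i. i < length vs \<and> i \<in> I})"
    by (rule card_Un_disjoint[symmetric]) auto
  also have "{i. i < length vs \<and> i \<in> - I} \<union> {i. i < length vs \<and> i \<in> I} = {..<length vs}"
    by auto
  finally show ?thesis by (simp add: length_nths)
qed

text \<open>Counting inversions by their first component gives an exponent that can be evaluated on
  explicit sets.\<close>

lemma shuffle_sign_eq:
  assumes "finite I"
  shows "shuffle_sign I = (-1) ^ (\<Sum>i\<in>I. card ({..<i} - I))"
proof -
  have "{(i, j). i \<in> I \<and> j \<notin> I \<and> j < i} = Sigma I (\<lambda>i. {..<i} - I)" by auto
  then show ?thesis using assms by (simp add: shuffle_sign_def)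
qed

lemma shuffle_sign_singleton: "shuffle_sign {m} = (-1) ^ m"
  by (simp add: shuffle_sign_eq)

section \<open>Monomial forms as determinants\<close>

lemma wedge_covector_left:
  "wedge (covector g) \<beta> vs = (\<Sum>m<length vs. (-1) ^ m * g (vs ! m) * \<beta> (nths vs (- {m})))"
proof -
  let ?t = "\<lambda>I. shuffle_sign I * covector g (nths vs I) * \<beta> (nths vs (- I))"
  \<comment> \<open>A covector vanishes on lists of length other than 1, so only singletons
    \<open>{m}\<close> survive; their sign is \<open>(-1) ^ m\<close> because \<open>m\<close>
    positions precede \<open>m\<close>.\<close>
  have "?t I = 0" if "I \<in> Pow {..<length vs} - (\<lambda>m. {m}) ` {..<length vs}" for I
  proof -
    have "card I \<noteq> 1" using that by (auto simp: card_1_singleton_iff)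
    then show ?thesis using that by (simp add: covector_def length_nths_Pow)
  qed
  then have "wedge (covector g) \<beta> vs = sum ?t ((\<lambda>m. {m}) ` {..<length vs})"
    unfolding wedge_def by (intro sum.mono_neutral_right) auto
  also have "\<dots> = (\<Sum>m<length vs. ?t {m})"
    by (subst sum.reindex) (auto simp: inj_on_def)
  finally show ?thesis
    by (simp add: shuffle_sign_singleton nths_singleton_nth covector_def)
qed

text \<open>Reading \<open>mono_form f is vs\<close> as the determinant with entries
  \<open>f (is ! p) (vs ! m)\<close>, this is the Laplace expansion along the first row.\<close>

lemma mono_form_row:
  "mono_form f (i # is) vs =
     (\<Sum>m<length vs. (-1) ^ m * f i (vs ! m) * mono_form f is (nths vs (- {m})))"
  by (simp add: mono_form_def wedge_covector_left)

lemma mono_form_Nil: "mono_form f [] vs = (if vs = [] then 1 else 0)"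
  by (simp add: mono_form_def unit_form_def)

lemma mono_form_Cons_Nil [simp]: "mono_form f (i # is) [] = 0"
  by (simp add: mono_form_row)

lemma mono_form_row_Cons:
  "mono_form f (i # is) (v # vs) = f i v * mono_form f is vs
     - (\<Sum>m<length vs. (-1) ^ m * f i (vs ! m) * mono_form f is (v # nths vs (- {m})))"
  by (simp add: mono_form_row[of f i "is" "v # vs"] sum.lessThan_Suc_shift sum_negf
      del: sum.lessThan_Suc)

text \<open>The Laplace expansion of the same determinant along its first column. The definition
  recurses on indices only; this rule removes the first vector instead and drives most later
  inductions.\<close>

lemma mono_form_column:
  "mono_form f is (v # vs) =
     (\<Sum>p<length is. (-1) ^ p * f (is ! p) v * mono_form f (nths is (- {p})) vs)"
proof (induction "is" arbitrary: vs)
  case Nil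
  show ?case by (simp add: mono_form_Nil)
next
  case (Cons i "is")
  \<comment> \<open>After the row expansion the minors that still contain \<open>v\<close> are
    expanded along \<open>v\<close>; exchanging the two sums then reassembles row expansions of the
    minors without \<open>v\<close>.\<close>
  have "(\<Sum>m<length vs. (-1) ^ m * f i (vs ! m) * mono_form f is (v # nths vs (- {m})))
      = (\<Sum>m<length vs. \<Sum>p<length is. (-1) ^ p * f (is ! p) v *
          ((-1) ^ m * f i (vs ! m) * mono_form f (nths is (- {p})) (nths vs (- {m}))))"
    unfolding Cons.IH by (simp add: sum_distrib_left mult.assoc mult.left_commute)
  also have "\<dots> = (\<Sum>p<length is. (-1) ^ p * f (is ! p) v * mono_form f (i # nths is (- {p})) vs)"
    by (subst sum.swap) (simp add: mono_form_row[of f i _ vs] sum_distrib_left)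
  finally show ?case
    by (simp add: mono_form_row_Cons sum.lessThan_Suc_shift sum_negf del: sum.lessThan_Suc)
qed

text \<open>Expand along the first row twice-split: the two terms in which \<open>f i\<close> takes
  \<open>v\<close> or \<open>w\<close> trade places with opposite signs, and in all others
  \<open>v\<close> and \<open>w\<close> stay in front, so induction applies.\<close>

lemma mono_form_swap: "mono_form f is (v # w # vs) = - mono_form f is (w # v # vs)"
proof (induction "is" arbitrary: vs)
  case Nil
  show ?case by (simp add: mono_form_Nil)
next
  case (Cons i "is")
  show ?case
    by (simp add: mono_form_row_Cons[of f i "is" _ "_ # vs"] sum.lessThan_Suc_shift
        Cons.IH[of "nths vs (- {_})"] sum_negf del: sum.lessThan_Suc)
qed

text \<open>A different second vector \<open>w\<close> is swapped to the front and expanded away,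
  until the two copies of \<open>v\<close> are adjacent; then the swap makes the value its own
  negative.\<close>

lemma mono_form_repeated: "v \<in> set vs \<Longrightarrow> mono_form f is (v # vs) = 0"
proof (induction vs arbitrary: "is")
  case (Cons w vs)
  show ?case
  proof (cases "w = v")
    case True
    then show ?thesis using mono_form_swap[of f "is" v v vs] by simp
  next
    case False
    then have "v \<in> set vs" using Cons.prems by simp
    then show ?thesis
      by (simp add: mono_form_swap[of f "is" v w] mono_form_column[of f "is" w] Cons.IH)
  qed
qed simp

text \<open>A column expansion removes one vector and one index, so the mismatch of lengths persists
  until one list is empty.\<close>

lemma mono_form_wrong_length: "length vs \<noteq> length is \<Longrightarrow> mono_form f is vs = 0"
proof (induction vs arbitrary: "is")
  case Nil
  then show ?case by (cases "is") auto
next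
  case (Cons v vs)
  have "length vs \<noteq> length (nths is (- {p}))" if "p < length is" for p
    using length_nths_Compl[of "is" "{p}"] nths_singleton_nth[OF that] Cons.prems by auto
  then show ?case
    by (simp add: mono_form_column Cons.IH)
qed

lemma mono_form_alternating:
  "i < j \<Longrightarrow> j < length vs \<Longrightarrow> vs ! i = vs ! j \<Longrightarrow> mono_form f is vs = 0"
proof (induction vs arbitrary: "is" i j)
  case (Cons v vs)
  obtain j' where j: "j = Suc j'" using Cons.prems by (cases j) auto
  show ?case
  proof (cases i)
    case 0
    then have "v \<in> set vs" using Cons.prems j by auto
    then show ?thesis by (rule mono_form_repeated)
  next
    case (Suc i')
    then show ?thesis
      using Cons.prems Cons.IH[of i' j'] j by (simp add: mono_form_column)
  qed
qed simp

lemma linear_const_mult: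
  fixes g :: "'a::real_vector \<Rightarrow> real"
  shows "linear g \<Longrightarrow> linear (\<lambda>x. c * g x)"
  using linear_compose_scale_right[of g c] by simp

lemma mono_form_linear:
  assumes "\<And>i. i \<in> set is \<Longrightarrow> linear (f i)" "i < length vs"
  shows "linear (\<lambda>x. mono_form f is (vs[i := x]))"
  using assms
proof (induction vs arbitrary: "is" i)
  case (Cons v vs)
  show ?case
  proof (cases i)
    case 0
    have "linear (f (is ! p))" if "p < length is" for p
      using Cons.prems that by simp
    then show ?thesis unfolding 0 list_update_code mono_form_column
      by (intro linear_compose_sum ballI linearI)
        (simp_all add: linear_add linear_scale algebra_simps)
  next
    case (Suc i')
    have "linear (\<lambda>x. mono_form f (nths is (- {p})) (vs[i' := x]))" for p
      using Cons.prems Suc by (intro Cons.IH) (auto dest: in_set_nthsD)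
    then show ?thesis unfolding Suc list_update_code mono_form_column
      by (intro linear_compose_sum ballI linear_const_mult)
  qed
qed simp

section \<open>Spaces of forms, pullback and vanishing rows\<close>

lemma mono_form_in_forms:
  assumes "\<And>i. i \<in> set is \<Longrightarrow> linear (f i)"
  shows "mono_form f is \<in> forms (length is)"
  using assms unfolding forms_def
  by (auto intro: mono_form_wrong_length mono_form_linear mono_form_alternating)

lemma forms_add: "\<alpha> \<in> forms k \<Longrightarrow> \<beta> \<in> forms k \<Longrightarrow> \<alpha> + \<beta> \<in> forms k"
  unfolding forms_def plus_fun_def by (auto intro: linear_compose_add)

lemma forms_diff: "\<alpha> \<in> forms k \<Longrightarrow> \<beta> \<in> forms k \<Longrightarrow> \<alpha> - \<beta> \<in> forms k"
  unfolding forms_def fun_diff_def by (auto intro: linear_compose_sub)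

text \<open>Pullback along \<open>g\<close>; it serves to restrict forms to the ideal along
  \<open>x\<close> to \<open>(x, 0)\<close>.\<close>

lemma mono_form_map: "mono_form f is (map g vs) = mono_form (\<lambda>i x. f i (g x)) is vs"
  by (induction "is" arbitrary: vs) (simp_all add: mono_form_Nil mono_form_row nths_map)

lemma mono_form_zero:
  assumes "j \<in> set is" "\<And>v. v \<in> set vs \<Longrightarrow> f j v = 0"
  shows "mono_form f is vs = 0"
  using assms
proof (induction "is" arbitrary: vs)
  case (Cons i "is")
  show ?case
  proof (cases "i = j")
    case True
    then show ?thesis using Cons.prems by (simp add: mono_form_row)
  next
    case False
    then have "mono_form f is (nths vs (- {m})) = 0" for m
      using Cons.prems by (intro Cons.IH) (auto dest: in_set_nthsD)
    then show ?thesis by (simp add: mono_form_row)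
  qed
qed simp

lemma mono_form_cong:
  "(\<And>i. i \<in> set is \<Longrightarrow> f i = g i) \<Longrightarrow> mono_form f is = mono_form g is"
  by (induction "is") (auto simp: mono_form_def)

subsection \<open>Dual bases\<close>

lemma dual_basis_linear:
  assumes "is_basis n e"
  shows "linear (dual_basis n e i)"
  using assms unfolding is_basis_def dual_basis_def
  by (intro linearI) (simp_all add: representation_add representation_scale)

lemma linear_eq_on_basis:
  assumes "is_basis n e" "linear f" "linear g" "\<And>i. i \<in> {1..n} \<Longrightarrow> f (e i) = g (e i)"
  shows "f v = g v"
proof (rule linear_eq_on_span[OF assms(2,3)])
  show "f x = g x" if "x \<in> e ` {1..n}" for x using assms(4) that by blast
  show "v \<in> span (e ` {1..n})" using assms(1) by (simp add: is_basis_def)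
qed

lemma linear_dual_basis_expansion:
  fixes g :: "'a::real_vector \<Rightarrow> real"
  assumes "is_basis n e" "linear g"
  shows "g v = (\<Sum>i=1..n. g (e i) * dual_basis n e i v)"
proof (rule linear_eq_on_basis[OF assms])
  show "linear (\<lambda>v. \<Sum>i=1..n. g (e i) * dual_basis n e i v)"
    by (intro linear_compose_sum ballI linear_const_mult dual_basis_linear[OF assms(1)])
  fix j assume "j \<in> {1..n}"
  then have "(\<Sum>i=1..n. g (e i) * dual_basis n e i (e j)) = (\<Sum>i=1..n. if i = j then g (e i) else 0)"
    using dual_basis_basis[OF assms(1)] by (intro sum.cong) auto
  then show "g (e j) = (\<Sum>i=1..n. g (e i) * dual_basis n e i (e j))"
    using \<open>j \<in> {1..n}\<close> by simp
qed

lemma dual_basis_is_dual_space_basis: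
  fixes e :: "nat \<Rightarrow> 'a::real_vector"
  assumes "is_basis n e"
  shows "is_dual_space_basis n (dual_basis n e)"
  unfolding is_dual_space_basis_def
proof (intro conjI ballI allI impI)
  fix c :: "nat \<Rightarrow> real" and j
  assume c: "\<forall>v. (\<Sum>i=1..n. c i * dual_basis n e i v) = 0" and j: "j \<in> {1..n}"
  have "(\<Sum>i=1..n. c i * dual_basis n e i (e j)) = (\<Sum>i=1..n. if i = j then c i else 0)"
    using dual_basis_basis[OF assms] j by (intro sum.cong) auto
  then show "c j = 0" using c j by simp
next
  fix g :: "'a \<Rightarrow> real" assume "linear g"
  then show "\<exists>c. \<forall>v. g v = (\<Sum>i=1..n. c i * dual_basis n e i v)"
    by (intro exI[of _ "\<lambda>i. g (e i)"] allI linear_dual_basis_expansion[OF assms])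
qed (rule dual_basis_linear[OF assms])

text \<open>The injection \<open>x\<close> to \<open>(x, 0)\<close> carries the basis to an
  independent set with span \<open>UNIV \<times> {0}\<close>; the generator \<open>(0, 1)\<close>
  lies outside this span and completes it.\<close>

lemma is_basis_semidirect_basis:
  assumes "is_basis n e"
  shows "is_basis (Suc n) (semidirect_basis n e)"
proof -
  let ?B = "(\<lambda>x. (x, 0::real)) ` e ` {1..n}"
  have lin: "linear (\<lambda>x::'a. (x, 0::real))" by (intro linearI) auto
  have e: "span (e ` {1..n}) = UNIV" "independent (e ` {1..n})" "inj_on e {1..n}"
    using assms by (simp_all add: is_basis_def)
  have sp: "span ?B = UNIV \<times> {0}"
    unfolding linear_span_image[OF lin] e(1) by auto
  have in_h: "semidirect_basis n e i = (e i, 0)" if "i \<in> {1..n}" for i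
    using that by (simp add: semidirect_basis_def)
  have gen: "semidirect_basis n e (Suc n) = (0, 1)"
    by (simp add: semidirect_basis_def)
  have Suc_n_disjoint: "{1..n} \<inter> {Suc n} = {}" by simp
  have Suc_n: "{1..Suc n} = insert (Suc n) {1..n}" by auto
  have img_h: "semidirect_basis n e ` {1..n} = ?B"
    unfolding image_image by (intro image_cong refl in_h)
  have img: "semidirect_basis n e ` {1..Suc n} = insert (0, 1) ?B"
    unfolding Suc_n image_insert img_h gen ..
  have "inj_on (semidirect_basis n e) {1..n}"
    using inj_onD[OF e(3)] by (intro inj_onI) (metis in_h prod.inject)
  moreover have "(0, 1) \<notin> ?B" by auto
  ultimately have "inj_on (semidirect_basis n e) {1..Suc n}"
    unfolding Suc_n inj_on_insert Diff_triv[OF Suc_n_disjoint] img_h gen by blast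
  moreover have "independent (insert (0, 1) ?B)"
  proof (rule independent_insertI)
    show "(0, 1) \<notin> span ?B" unfolding sp by simp
    show "independent ?B"
      by (intro linear_independent_injective_image[OF lin] e(2)) (simp add: inj_on_def)
  qed
  moreover have "x \<in> span (insert (0, 1) ?B)" for x
  proof -
    have "(fst x, 0) \<in> span ?B" unfolding sp by simp
    then have "(fst x, 0) \<in> span (insert (0, 1) ?B)"
      using span_mono[OF subset_insertI] by blast
    moreover have "(0, 1) \<in> span (insert (0, 1) ?B)"
      by (intro span_base insertI1)
    ultimately have "(fst x, 0) + snd x *\<^sub>R (0, 1) \<in> span (insert (0, 1) ?B)"
      by (intro span_add span_scale)
    then show ?thesis by simp
  qed
  then have "span (insert (0, 1) ?B) = UNIV" by blast
  ultimately show ?thesis unfolding is_basis_def img by blast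
qed

lemma dual_basis_semidirect:
  assumes "is_basis n e" "i \<in> {1..n}"
  shows "dual_basis (Suc n) (semidirect_basis n e) i (x, 0) = dual_basis n e i x"
proof (rule linear_eq_on_basis[OF assms(1)])
  note B = is_basis_semidirect_basis[OF assms(1)]
  have "linear (\<lambda>x::'a. (x, 0::real))" by (intro linearI) auto
  from linear_compose[OF this dual_basis_linear[OF B]]
  show "linear (\<lambda>x. dual_basis (Suc n) (semidirect_basis n e) i (x, 0))" by (simp add: o_def)
  show "linear (dual_basis n e i)" by (rule dual_basis_linear[OF assms(1)])
  fix j assume j: "j \<in> {1..n}"
  then have "(e j, 0) = semidirect_basis n e j" by (simp add: semidirect_basis_def)
  then show "dual_basis (Suc n) (semidirect_basis n e) i (e j, 0) = dual_basis n e i (e j)"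
    using dual_basis_basis[OF B, of i j] dual_basis_basis[OF assms(1), of i j] assms(2) j by simp
qed

lemma dual_basis_semidirect_generator:
  assumes "is_basis n e"
  shows "dual_basis (Suc n) (semidirect_basis n e) (Suc n) (x, 0) = 0"
proof -
  note B = is_basis_semidirect_basis[OF assms(1)]
  have "linear (\<lambda>x::'a. (x, 0::real))" by (intro linearI) auto
  from linear_compose[OF this dual_basis_linear[OF B]]
  have L: "linear (\<lambda>x. dual_basis (Suc n) (semidirect_basis n e) (Suc n) (x, 0))"
    by (simp add: o_def)
  show ?thesis
  proof (rule linear_eq_on_basis[OF assms L linear_zero])
    fix j assume j: "j \<in> {1..n}"
    then have "(e j, 0) = semidirect_basis n e j" by (simp add: semidirect_basis_def)
    then show "dual_basis (Suc n) (semidirect_basis n e) (Suc n) (e j, 0) = 0"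
      using dual_basis_basis[OF B, of "Suc n" j] j by simp
  qed
qed

subsection \<open>The Hodge star\<close>

text \<open>Equal leading indices reduce to the tails by a column expansion; different ones produce
  a zero row or a zero column.\<close>

lemma mono_form_dual_basis:
  assumes "is_basis n e" "sorted_wrt (<) is" "sorted_wrt (<) js"
    "set is \<subseteq> {1..n}" "set js \<subseteq> {1..n}"
  shows "mono_form (dual_basis n e) is (map e js) = (if is = js then 1 else 0)"
  using assms(2-)
proof (induction "is" arbitrary: js)
  case Nil
  then show ?case by (simp add: mono_form_Nil)
next
  case (Cons i "is")
  note db = dual_basis_basis[OF assms(1)]
  show ?case
  proof (cases js)
    case Nil
    then show ?thesis by simp
  next
    case (Cons j js')
    note js = this
    \<comment> \<open>Both lists increase, so the smaller of two different leading indices is absent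
      from the other list.\<close>
    consider "i = j" | "i \<notin> set js" | "j \<notin> set (i # is)"
      using Cons.prems js by (cases i j rule: linorder_cases) force+
    then show ?thesis
    proof cases
      case 1
      have "is ! p \<noteq> i" "is ! p \<in> {1..n}" if "p < length is" for p
        using Cons.prems nth_mem[OF that] by (auto simp del: nth_mem)
      then show ?thesis
        using 1 Cons.prems Cons.IH[of js'] js
        by (simp add: mono_form_column sum.lessThan_Suc_shift db del: sum.lessThan_Suc)
    next
      case 2
      then have "mono_form (dual_basis n e) (i # is) (map e js) = 0"
        using Cons.prems db[of i] by (intro mono_form_zero[of i]) auto
      then show ?thesis using 2 by auto
    next
      case 3
      then have "(i # is) ! p \<noteq> j \<and> (i # is) ! p \<in> {1..n}" if "p < length (i # is)" for p
        using Cons.prems nth_mem[OF that] by auto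
      moreover have "j \<in> {1..n}" using Cons.prems js by auto
      ultimately have "mono_form (dual_basis n e) (i # is) (map e js) = 0"
        unfolding js list.map mono_form_column by (intro sum.neutral) (simp add: db)
      then show ?thesis using 3 js by auto
    qed
  qed
qed

text \<open>At most one position of a distinct list holds \<open>j\<close>. Expressing that position
  and the remaining list by \<open>takeWhile\<close> and \<open>remove1\<close> makes contractions
  with basis vectors computable on explicit lists.\<close>

lemma sum_nths_remove1:
  fixes g :: "nat \<Rightarrow> 'a list \<Rightarrow> real"
  assumes "distinct xs"
  shows "(\<Sum>p<length xs. if xs ! p = j then g p (nths xs (- {p})) else 0)
    = (if j \<in> set xs then g (length (takeWhile (\<lambda>x. x \<noteq> j) xs)) (remove1 j xs) else 0)"
  using assms
proof (induction xs arbitrary: g)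
  case (Cons x xs)
  then show ?case
    using Cons.IH[of "\<lambda>p ys. g (Suc p) (x # ys)"]
    by (auto simp: sum.lessThan_Suc_shift simp del: sum.lessThan_Suc cong: if_cong)
qed simp

lemma mono_form_dual_basis_contract:
  assumes "is_basis n e" "set is \<subseteq> {1..n}" "distinct is" "j \<in> set is"
  shows "mono_form (dual_basis n e) is (e j # vs) =
    (-1) ^ length (takeWhile (\<lambda>i. i \<noteq> j) is) * mono_form (dual_basis n e) (remove1 j is) vs"
proof -
  have "dual_basis n e (is ! p) (e j) = (if is ! p = j then 1 else 0)" if "p < length is" for p
    using assms nth_mem[OF that] by (intro dual_basis_basis) (auto simp del: nth_mem)
  then have "mono_form (dual_basis n e) is (e j # vs) = (\<Sum>p<length is.
      if is ! p = j then (-1) ^ p * mono_form (dual_basis n e) (nths is (- {p})) vs else 0)"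
    unfolding mono_form_column by (intro sum.cong) auto
  then show ?thesis
    using sum_nths_remove1[OF assms(3),
        of j "\<lambda>p ks. (-1) ^ p * mono_form (dual_basis n e) ks vs"] assms(4) by simp
qed

text \<open>Among increasing index lists only \<open>is\<close> itself gives a nonzero value on the
  basis vectors, so one summand of the star remains.\<close>

lemma hodge_star_mono_form:
  assumes "is_basis n e" "sorted_wrt (<) is" "set is \<subseteq> {1..n}"
  shows "hodge_star n e (mono_form (dual_basis n e) is) vs = volume_form n e (map e is @ vs)"
proof -
  have "mono_form (dual_basis n e) is (map e (sorted_list_of_set I)) = (if I = set is then 1 else 0)"
    if "I \<in> Pow {1..n}" for I
  proof -
    have "finite I" using that finite_subset by auto
    moreover have "is = sorted_list_of_set I \<longleftrightarrow> I = set is"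
      using assms(2) \<open>finite I\<close>
      by (metis set_sorted_list_of_set sorted_list_of_set.idem_if_sorted_distinct strict_sorted_iff)
    ultimately show ?thesis
      using mono_form_dual_basis[OF assms(1,2), of "sorted_list_of_set I"] assms(3) that by auto
  qed
  then have "hodge_star n e (mono_form (dual_basis n e) is) vs
      = (\<Sum>I\<in>Pow {1..n}. if I = set is
          then volume_form n e (map e (sorted_list_of_set I) @ vs) else 0)"
    unfolding hodge_star_def by (intro sum.cong) auto
  also have "\<dots> = volume_form n e (map e (sorted_list_of_set (set is)) @ vs)"
    using assms(3) by simp
  also have "sorted_list_of_set (set is) = is"
    using assms(2) by (simp add: sorted_list_of_set.idem_if_sorted_distinct strict_sorted_iff)
  finally show ?thesis .
qed

lemma hodge_star_add: "hodge_star n e (\<alpha> + \<beta>) vs = hodge_star n e \<alpha> vs + hodge_star n e \<beta> vs"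
  by (simp add: hodge_star_def sum.distrib algebra_simps)

lemma hodge_star_diff: "hodge_star n e (\<alpha> - \<beta>) vs = hodge_star n e \<alpha> vs - hodge_star n e \<beta> vs"
  by (simp add: hodge_star_def sum_subtractf algebra_simps)

text \<open>Each monomial is sent to the contraction of the volume form with its three basis
  vectors, taken one after the other.\<close>

lemma hodge_star_g2_form:
  assumes "is_basis 7 e"
  defines "f \<equiv> dual_basis 7 e"
  shows "hodge_star 7 e (g2_form f) =
    mono_form f [1,2,3,4] + mono_form f [1,2,5,6] + mono_form f [3,4,5,6]
    + mono_form f [1,3,5,7] - mono_form f [1,4,6,7] - mono_form f [2,3,6,7] - mono_form f [2,4,5,7]"
proof
  fix vs
  have vol: "volume_form 7 e = mono_form f [1,2,3,4,5,6,7]"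
    by (simp add: volume_form_def f_def upt_rec numeral_eq_Suc)
  note contract = mono_form_dual_basis_contract[OF assms(1), folded f_def]
  note star = hodge_star_mono_form[OF assms(1), folded f_def, unfolded vol]
  show "hodge_star 7 e (g2_form f) vs =
    (mono_form f [1,2,3,4] + mono_form f [1,2,5,6] + mono_form f [3,4,5,6]
    + mono_form f [1,3,5,7] - mono_form f [1,4,6,7] - mono_form f [2,3,6,7] - mono_form f [2,4,5,7]) vs"
    unfolding g2_form_def hodge_star_add hodge_star_diff
    by (simp add: star contract)
qed

subsection \<open>Explicit formulas in low degree\<close>

lemma mono_form_column1: "mono_form f [i] (v # vs) = f i v * mono_form f [] vs"
  by (simp add: mono_form_column)

lemma mono_form_column2:
  "mono_form f [i, j] (v # vs) = f i v * mono_form f [j] vs - f j v * mono_form f [i] vs"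
  by (simp add: mono_form_column[of f "[i, j]"])

lemma mono_form_column3:
  "mono_form f [i, j, k] (v # vs) =
     f i v * mono_form f [j, k] vs - f j v * mono_form f [i, k] vs + f k v * mono_form f [i, j] vs"
  by (simp add: mono_form_column[of f "[i, j, k]"])

lemma mono_form_column4:
  "mono_form f [i, j, k, l] (v # vs) =
     f i v * mono_form f [j, k, l] vs - f j v * mono_form f [i, k, l] vs
     + f k v * mono_form f [i, j, l] vs - f l v * mono_form f [i, j, k] vs"
  by (simp add: mono_form_column[of f "[i, j, k, l]"])

lemmas mono_form_columns =
  mono_form_column1 mono_form_column2 mono_form_column3 mono_form_column4 mono_form_Nil

definition symplectic_form :: "(nat \<Rightarrow> 'a \<Rightarrow> real) \<Rightarrow> 'a form" where
  "symplectic_form f = mono_form f [1,2] + mono_form f [3,4] + mono_form f [5,6]"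

definition half_square_form :: "(nat \<Rightarrow> 'a \<Rightarrow> real) \<Rightarrow> 'a form" where
  "half_square_form f = mono_form f [1,2,3,4] + mono_form f [1,2,5,6] + mono_form f [3,4,5,6]"

definition psi_plus :: "(nat \<Rightarrow> 'a \<Rightarrow> real) \<Rightarrow> 'a form" where
  "psi_plus f = mono_form f [1,3,5] - mono_form f [1,4,6] - mono_form f [2,3,6] - mono_form f [2,4,5]"

lemma symplectic_form_wrong_length: "length vs \<noteq> 2 \<Longrightarrow> symplectic_form f vs = 0"
  by (simp add: symplectic_form_def mono_form_wrong_length)

lemma half_square_form_wrong_length: "length vs \<noteq> 4 \<Longrightarrow> half_square_form f vs = 0"
  by (simp add: half_square_form_def mono_form_wrong_length)

lemma symplectic_form_skew: "symplectic_form f [x, y] = - symplectic_form f [y, x]"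
  by (simp add: symplectic_form_def mono_form_columns algebra_simps)

text \<open>The Pfaffian of the matrix of \<open>\<omega>\<^sub>0\<close> on four vectors. It
  reduces both the wedge square and the action of \<open>D\<close> to values of
  \<open>\<omega>\<^sub>0\<close>.\<close>

lemma half_square_form_eq:
  "half_square_form f [a, b, c, d] =
     symplectic_form f [a, b] * symplectic_form f [c, d]
     - symplectic_form f [a, c] * symplectic_form f [b, d]
     + symplectic_form f [a, d] * symplectic_form f [b, c]"
  by (simp add: half_square_form_def symplectic_form_def mono_form_columns algebra_simps)

text \<open>Unfolds a sum over all subsets of an explicit finite set, here the 16 sets of positions
  in a list of length four.\<close>

lemma sum_Pow_insert:
  fixes g :: "'a set \<Rightarrow> real"
  assumes "finite A" "x \<notin> A"
  shows "sum g (Pow (insert x A)) = sum g (Pow A) + (\<Sum>B\<in>Pow A. g (insert x B))"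
proof -
  have "sum g (Pow (insert x A)) = sum g (Pow A) + sum g (insert x ` Pow A)"
    unfolding Pow_insert using assms by (intro sum.union_disjoint) auto
  also have "sum g (insert x ` Pow A) = (\<Sum>B\<in>Pow A. g (insert x B))"
    using assms by (subst sum.reindex) (auto simp: inj_on_def)
  finally show ?thesis .
qed

lemma wedge_symplectic_form:
  "wedge (symplectic_form f) (symplectic_form f) = (\<lambda>vs. 2 * half_square_form f vs)"
proof
  fix vs
  show "wedge (symplectic_form f) (symplectic_form f) vs = 2 * half_square_form f vs"
  proof (cases "length vs = 4")
    case True
    then obtain a b c d where vs: "vs = [a, b, c, d]"
      by (auto simp: numeral_eq_Suc length_Suc_conv)
    have lt: "{..<length vs} = {3, 2, 1, 0}" by (auto simp: vs)
    show ?thesis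
      unfolding wedge_def lt
      \<comment> \<open>Only the six sets of two positions contribute; complementary sets give equal
        terms, hence the factor 2 in front of the Pfaffian.\<close>
      by (simp add: vs sum_Pow_insert symplectic_form_wrong_length nths_Cons shuffle_sign_eq
          numeral_eq_Suc lessThan_Suc insert_Diff_if half_square_form_eq)
  next
    case False
    have "symplectic_form f (nths vs I) * symplectic_form f (nths vs (- I)) = 0" for I
      using length_nths_Compl[of vs I] False
      by (cases "length (nths vs I) = 2") (simp_all add: symplectic_form_wrong_length)
    then have "wedge (symplectic_form f) (symplectic_form f) vs = 0"
      unfolding wedge_def by (intro sum.neutral) auto
    then show ?thesis
      using False by (simp add: half_square_form_wrong_length)
  qed
qed

subsection \<open>The differential of a semidirect extension\<close>

text \<open>With the larger index outside, splitting off the first vector becomes a shift of both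
  summation indices.\<close>

lemma ce_d_eq:
  "ce_d br \<alpha> vs = (\<Sum>j<length vs. \<Sum>i<j.
     (-1) ^ (i + j) * \<alpha> (br (vs ! i) (vs ! j) # nths vs (- {i, j})))"
proof -
  have "{(i, j). i < j \<and> j < length vs} = prod.swap ` Sigma {..<length vs} (\<lambda>j. {..<j})"
    by (auto simp: image_iff)
  then show ?thesis
    by (simp add: ce_d_def sum.Sigma sum.reindex split_beta)
qed

lemma nths_Cons_Compl_0_Suc [simp]: "nths (v # vs) (- {0, Suc j}) = nths vs (- {j})"
proof -
  have "{k. Suc k \<in> - {0, Suc j}} = - {j}" by auto
  then show ?thesis by (simp add: nths_Cons)
qed

lemma nths_Cons_Compl_Suc_Suc [simp]:
  "nths (v # vs) (- {Suc i, Suc j}) = v # nths vs (- {i, j})"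
proof -
  have "{k. Suc k \<in> - {Suc i, Suc j}} = - {i, j}" by auto
  then show ?thesis by (simp add: nths_Cons)
qed

text \<open>For an alternating form this is Cartan's formula: contracting \<open>d\<close> with
  \<open>v\<close> gives the Lie derivative along \<open>v\<close> minus \<open>d\<close> of the
  contraction. Here \<open>v\<close> sits in the second slot, behind the bracket, which absorbs the
  sign of the latter term.\<close>

lemma ce_d_Cons:
  "ce_d br \<alpha> (v # vs) =
     ce_d br (\<lambda>us. \<alpha> (hd us # v # tl us)) vs
     - (\<Sum>j<length vs. (-1) ^ j * \<alpha> (br v (vs ! j) # nths vs (- {j})))"
  by (simp add: ce_d_eq sum.lessThan_Suc_shift sum_subtractf del: sum.lessThan_Suc)

text \<open>The differential commutes with pullback along a map that preserves brackets.\<close>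

lemma ce_d_map:
  assumes "\<And>x y. br' (g x) (g y) = g (br x y)"
  shows "ce_d br' \<alpha> (map g vs) = ce_d br (\<lambda>us. \<alpha> (map g us)) vs"
  unfolding ce_d_eq by (simp add: assms nths_map)

lemma ce_d_scale: "ce_d br (\<lambda>vs. c * \<alpha> vs) vs = c * ce_d br \<alpha> vs"
  by (simp add: ce_d_eq sum_distrib_left mult.left_commute)

text \<open>The Lie derivative of \<open>\<omega>\<^sub>0\<^sup>2\<close> along \<open>D\<close>, with \<open>D x\<^sub>j\<close> moved to the first
  argument.\<close>

lemma half_square_form_invariant:
  assumes "in_sp6 e D"
  shows "(\<Sum>j<length xs.
    (-1) ^ j * half_square_form (dual_basis 6 e) (D (xs ! j) # nths xs (- {j}))) = 0"
proof (cases "length xs = 4")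
  case True
  then obtain a b c d where xs: "xs = [a, b, c, d]"
    by (auto simp: numeral_eq_Suc length_Suc_conv)
  let ?W = "symplectic_form (dual_basis 6 e)"
  have "?W [D x, y] + ?W [x, D y] = 0" for x y
    using assms by (simp add: in_sp6_def Let_def symplectic_form_def)
  \<comment> \<open>Combined with skew-symmetry, the symplectic condition makes
    \<open>\<omega>\<^sub>0(D x, y)\<close> symmetric in \<open>x\<close> and \<open>y\<close>; the
    Pfaffian terms of the alternating sum then cancel in pairs.\<close>
  then have S: "?W [D x, y] = ?W [D y, x]" for x y
    using symplectic_form_skew[of _ x "D y"] by (metis add.inverse_unique minus_minus)
  show ?thesis
    using S[of a b] S[of a c] S[of a d] S[of b c] S[of b d] S[of c d]
    by (simp add: xs half_square_form_eq algebra_simps)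
next
  case False
  have "length (D (xs ! j) # nths xs (- {j})) \<noteq> 4" if "j < length xs" for j
    using length_nths_Compl[of xs "{j}"] False that by (simp add: nths_singleton_nth)
  then show ?thesis by (simp add: half_square_form_wrong_length)
qed

section \<open>The half-flat structure on the ideal\<close>

theorem proposition2p5:
  fixes br :: "'a::real_vector \<Rightarrow> 'a \<Rightarrow> 'a"
    and e :: "nat \<Rightarrow> 'a"
    and D :: "'a \<Rightarrow> 'a"
    and e' :: "nat \<Rightarrow> 'a \<times> real"
    and \<phi> :: "('a \<times> real) form"
  assumes "lie_algebra br"
    and "is_basis 6 e"
    and "derivation br D"
    and "in_sp6 e D"
    and "e' = semidirect_basis 6 e"
    and "\<phi> = g2_form (dual_basis 7 e')"
    and "coclosed (semidirect_bracket br D) 7 e' \<phi>"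
  shows "\<exists>\<omega> \<psi>. su3_structure \<omega> \<psi> \<and> half_flat br \<omega> \<psi>"
proof -
  define f where "f = dual_basis 6 e"
  define f' where "f' = dual_basis 7 e'"
  define F where "F = hodge_star 7 e' \<phi>"
  let ?emb = "\<lambda>x::'a. (x, 0::real)"
  have B: "is_basis 7 e'"
    using is_basis_semidirect_basis[OF assms(2)] assms(5) by simp
  have F: "F = half_square_form f' + mono_form f' [1,3,5,7] - mono_form f' [1,4,6,7]
      - mono_form f' [2,3,6,7] - mono_form f' [2,4,5,7]"
    using hodge_star_g2_form[OF B] assms(6) by (simp add: F_def f'_def half_square_form_def)
  have closed: "ce_d (semidirect_bracket br D) F vs = 0" for vs
    using assms(7) by (simp add: coclosed_def F_def)
  have f'_h: "f' i (x, 0) = f i x" if "i \<in> {1..6}" for i x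
    using dual_basis_semidirect[OF assms(2) that] by (simp add: f_def f'_def assms(5))
  have f'_7: "f' 7 (x, 0) = 0" for x
    using dual_basis_semidirect_generator[OF assms(2)] by (simp add: f'_def assms(5))
  have e'_7: "(0, 1) = e' 7" by (simp add: assms(5) semidirect_basis_def)
  have f'_e7: "f' i (0, 1) = (if i = 7 then 1 else 0)" if "i \<in> {1..7}" for i
    unfolding e'_7 f'_def using dual_basis_basis[OF B that, of 7] by simp
  have mono_h: "mono_form f' is (map ?emb xs) = mono_form f is xs" if "set is \<subseteq> {1..6}" for "is" xs
  proof -
    have "mono_form (\<lambda>i x. f' i (x, 0)) is = mono_form f is"
      using that f'_h by (intro mono_form_cong) auto
    then show ?thesis by (simp add: mono_form_map)
  qed
  have mono_7: "mono_form f' is (map ?emb xs) = 0" if "7 \<in> set is" for "is" xs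
    using that f'_7 by (intro mono_form_zero[of 7]) auto
  have F_h: "F (map ?emb xs) = half_square_form f xs" for xs
    by (simp add: F half_square_form_def mono_h mono_7)
  \<comment> \<open>The generator stands second because the bracket comes first in
    \<open>ce_d\<close>. Moving it to the front costs one sign and contracting it with the last
    index 7, past three others, costs a second, so \<open>\<psi>\<^sub>+\<close> appears with sign
    plus.\<close>
  have F_7: "F ((y, 0) # (0, 1) # map ?emb xs) = psi_plus f (y # xs)" for y xs
  proof -
    have swap: "mono_form f' is ((y, 0) # (0, 1) # map ?emb xs)
        = - mono_form f' is ((0, 1) # map ?emb (y # xs))" for "is"
      unfolding list.map by (rule mono_form_swap)
    have "mono_form f' [i, j, k, l] ((0, 1) # map ?emb zs)
        = (if l = 7 then - mono_form f [i, j, k] zs else 0)"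
      if "{i, j, k} \<subseteq> {1..6}" "l \<in> {1..7}" for i j k l zs
      using that mono_h[of "[i, j, k]" zs] by (simp add: mono_form_column4 f'_e7)
    then show ?thesis
      by (simp add: F half_square_form_def psi_plus_def swap del: list.map)
  qed
  have br0: "br 0 y = 0" for y
    using assms(1) by (auto simp: lie_algebra_def intro: bilinear_lzero)
  have D0: "D 0 = 0"
    using assms(3) by (auto simp: derivation_def linear_0)
  have "ce_d br (half_square_form f) xs = 0" for xs
    using closed[of "map ?emb xs"]
    by (simp add: ce_d_map[where g = ?emb and br = br] semidirect_bracket_def D0 F_h)
  then have d_square: "ce_d br (wedge (symplectic_form f) (symplectic_form f)) = 0"
    by (auto simp: wedge_symplectic_form ce_d_scale)
  have "ce_d br (psi_plus f) xs = 0" for xs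
  proof -
    \<comment> \<open>This is the first term of \<open>ce_d_Cons\<close> for the generator followed
      by vectors of the ideal; only brackets within the ideal occur in it.\<close>
    have "ce_d (semidirect_bracket br D) (\<lambda>us. F (hd us # (0, 1) # tl us)) (map ?emb xs)
        = ce_d br (\<lambda>us. F (?emb (hd us) # (0, 1) # map ?emb (tl us))) xs"
      unfolding ce_d_eq by (simp add: semidirect_bracket_def nths_map)
    also have "\<dots> = ce_d br (psi_plus f) xs"
      unfolding ce_d_eq F_7 by simp
    finally have 1: "ce_d (semidirect_bracket br D) (\<lambda>us. F (hd us # (0, 1) # tl us)) (map ?emb xs)
        = ce_d br (psi_plus f) xs" .
    \<comment> \<open>In the second term the bracket with the generator is
      \<open>D (xs ! j)\<close>, so all arguments lie in the ideal and only the part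
      \<open>\<omega>\<^sub>0\<^sup>2/2\<close> of \<open>F\<close> is seen.\<close>
    have "F (semidirect_bracket br D (0, 1) (map ?emb xs ! j) # nths (map ?emb xs) (- {j}))
        = half_square_form f (D (xs ! j) # nths xs (- {j}))" if "j < length xs" for j
      using that F_h[of "D (xs ! j) # nths xs (- {j})"]
      by (simp add: semidirect_bracket_def br0 nths_map)
    then show ?thesis
      using closed[of "(0, 1) # map ?emb xs"] half_square_form_invariant[OF assms(4), of xs]
      by (simp add: ce_d_Cons 1 f_def)
  qed
  then have d_psi: "ce_d br (psi_plus f) = 0" by auto
  have lin: "linear (f i)" for i
    using dual_basis_linear[OF assms(2)] by (simp add: f_def)
  have "mono_form f [i, j] \<in> forms 2" "mono_form f [i, j, k] \<in> forms 3" for i j k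
    using mono_form_in_forms[of "[i, j]" f] mono_form_in_forms[of "[i, j, k]" f] lin
    by (simp_all add: numeral_eq_Suc)
  then have "symplectic_form f \<in> forms 2" "psi_plus f \<in> forms 3"
    unfolding symplectic_form_def psi_plus_def by (intro forms_add forms_diff; blast)+
  \<comment> \<open>The dual basis \<open>f\<close> is itself the adapted coframe.\<close>
  then have "su3_structure (symplectic_form f) (psi_plus f)"
    using dual_basis_is_dual_space_basis[OF assms(2)] unfolding su3_structure_def
    by (intro conjI exI[of _ f]) (simp_all add: symplectic_form_def psi_plus_def f_def)
  with d_square d_psi show ?thesis
    unfolding half_flat_def by blast
qed

end
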